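(* Let $p$ be an odd prime, let $d\ge 1$ be an integer such that $-1$ is a power of $p$ modulo $2d$, let $t$ be the smallest positive integer with $p^t\equiv -1 \pmod{2d}$, and let $q=p^{2rt}$ with $r$ an even positive integer. Let $I=\{m_1,\dots,m_d\}\subset\{0,1,\dots,2d-1\}$ with $|I|=d$, and let $X=PP(q,2d,I)$. Then $\omega(X)\le \sqrt{q}$. Moreover, if $\omega(X)=\sqrt{q}$ and $A$ is a clique of $X$ of size $\sqrt{q}$ with $0\in A$, then $$|A\cap C_{m_1}|=|A\cap C_{m_2}|=\cdots=|A\cap C_{m_d}|=\frac{\sqrt{q}-1}{d}.$$
   Context: $\mathbb{F}_q$ is the finite field with $q$ elements and $g$ is a fixed primitive root of $\mathbb{F}_q$. For a positive integer $N\mid q-1$, the $N$-th cyclotomic classes are $C_j=g^j\langle g^N\rangle$ ($j\in\mathbb{Z}$, indices taken modulo $N$); here $N=2d$. For $2d\mid q-1$ and $I=\{m_1,\dots,m_d\}\subset\{0,\dots,2d-1\}$ with $|I|=d$, $PP(q,2d,I)$ is the Cayley graph $\mathrm{Cay}(\mathbb{F}_q^+,D)$ with vertex set $\mathbb{F}_q$, where $x,y$ are adjacent iff $x-y\in D$, and $D=\bigcup_{j=1}^d C_{m_j}$ (the $C_j$ being $2d$-th cyclotomic classes). A clique is a set of pairwise adjacent vertices and $\omega(X)$ is the maximum size of a clique. *)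

theory Defs
  imports Complex_Main "HOL-Library.Cardinality" "HOL-Library.Ramsey" "HOL-Number_Theory.Cong"
begin

definition field_primitive_root :: "'a::{field,finite} \<Rightarrow> bool" where
  "field_primitive_root g \<longleftrightarrow> g \<noteq> 0 \<and> (\<forall>x. x \<noteq> 0 \<longrightarrow> (\<exists>k::nat. x = g ^ k))"

text \<open>The coset \<open>g\<^sup>j \<langle>g\<^sup>N\<rangle>\<close> of the multiplicative group.\<close>

definition cyclotomic_class :: "'a::{field,finite} \<Rightarrow> nat \<Rightarrow> int \<Rightarrow> 'a set" where
  "cyclotomic_class g N j = (\<lambda>h. g powi j * h) ` range (\<lambda>k::int. (g ^ N) powi k)"

text \<open>
  Edges are unordered pairs, as in \<^const>\<open>clique\<close>.  For a connection set with \<open>D = - D\<close> and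
  \<open>0 \<notin> D\<close> this is the relation \<open>x - y \<in> D\<close>; see \<open>PP_edge_iff\<close> below.
\<close>

definition cayley_edges :: "'a::ab_group_add set \<Rightarrow> 'a set set" where
  "cayley_edges D = {{x, y} | x y. x - y \<in> D}"

text \<open>The order \<open>q\<close> of the field is carried by the type; the vertex set is \<^term>\<open>UNIV\<close>.\<close>

definition PP_connection_set :: "'a::{field,finite} \<Rightarrow> nat \<Rightarrow> nat set \<Rightarrow> 'a set" where
  "PP_connection_set g N I = (\<Union>m\<in>I. cyclotomic_class g N (int m))"

definition PP_edges :: "'a::{field,finite} \<Rightarrow> nat \<Rightarrow> nat set \<Rightarrow> 'a set set" where
  "PP_edges g N I = cayley_edges (PP_connection_set g N I)"

definition clique_number :: "'a set \<Rightarrow> 'a set set \<Rightarrow> nat" where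
  "clique_number V E = Max (card ` {A. A \<subseteq> V \<and> clique A E})"

lemma minus_one_eq_power:
  fixes g :: "'a::{field,finite}"
  assumes g: "field_primitive_root g" and N: "2 * N dvd CARD('a) - 1"
  shows "\<exists>k. - 1 = (g ^ N) ^ k"
proof -
  let ?n = "CARD('a) - 1"
  from N obtain c where c: "?n = 2 * N * c" by (elim dvdE)
  have g0: "g \<noteq> 0" using g by (simp add: field_primitive_root_def)
  have npos: "?n > 0"
    using card_mono[of UNIV "{0, 1::'a}"] by simp
  have fermat: "g ^ ?n = 1"
  proof -
    have bij: "bij_betw ((*) g) (UNIV - {0}) (UNIV - {0})"
      by (rule bij_betw_byWitness[where f' = "\<lambda>x. x / g"]) (use g0 in auto)
    have "(\<Prod>x\<in>UNIV - {0}. x) = (\<Prod>x\<in>UNIV - {0}. g * x)"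
      by (rule prod.reindex_bij_betw[OF bij, symmetric])
    also have "\<dots> = g ^ ?n * (\<Prod>x\<in>UNIV - {0}. x)"
      by (simp add: prod.distrib card_Diff_singleton)
    finally show ?thesis by (simp add: prod_zero_iff)
  qed
  define u where "u = g ^ (N * c)"
  have "u ^ 2 = 1"
    using fermat unfolding c u_def power_mult[symmetric] by (simp add: mult_ac)
  then consider "u = 1" | "u = - 1" by (auto simp: power2_eq_1_iff)
  then show ?thesis
  proof cases
    case 2
    then show ?thesis unfolding u_def power_mult by metis
  next
    case 1
    have pos: "N * c > 0" using npos c by (intro Nat.gr0I) auto
    have "UNIV - {0} \<subseteq> (\<lambda>i. g ^ i) ` {..<N * c}"
    proof
      fix x :: 'a assume "x \<in> UNIV - {0}"
      then obtain k where k: "x = g ^ k" using g by (auto simp: field_primitive_root_def)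
      have "g ^ k = g ^ (k mod (N * c) + N * c * (k div (N * c)))" by simp
      also have "\<dots> = g ^ (k mod (N * c))"
        using 1 by (simp only: power_add power_mult[of g "N * c"] u_def[symmetric]) simp
      finally show "x \<in> (\<lambda>i. g ^ i) ` {..<N * c}"
        using k pos by auto
    qed
    then have "card (UNIV - {0::'a}) \<le> N * c"
      using card_image_le[of "{..<N * c}" "\<lambda>i. g ^ i"] card_mono
      by (metis card_lessThan finite_imageI finite_lessThan order_trans)
    then show ?thesis using c pos by (simp add: card_Diff_singleton)
  qed
qed

text \<open>
  With \<open>N = 2 * d\<close> the divisibility assumption is \<open>4 * d dvd q - 1\<close>.  It holds for \<open>q = p ^ (2 * r * t)\<close>
  with \<open>p\<close> odd, \<open>r\<close> even and \<open>p ^ t\<close> congruent to \<open>-1\<close> modulo \<open>2 * d\<close>: in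
  \<open>q - 1 = (p ^ (r * t) - 1) * (p ^ (r * t) + 1)\<close> the first factor is divisible by \<open>2 * d\<close> and the
  second is even.
\<close>

lemma PP_edge_iff:
  fixes g :: "'a::{field,finite}"
  assumes g: "field_primitive_root g" and N: "2 * N dvd CARD('a) - 1"
  shows "{x, y} \<in> PP_edges g N I \<longleftrightarrow> x - y \<in> PP_connection_set g N I"
proof -
  let ?D = "PP_connection_set g N I"
  obtain k where k: "- 1 = (g ^ N) ^ k" using minus_one_eq_power[OF g N] by blast
  have g0: "g ^ N \<noteq> 0" using g by (simp add: field_primitive_root_def)
  have sym: "- z \<in> ?D" if "z \<in> ?D" for z
  proof -
    from that obtain m i where m: "m \<in> I" and z: "z = g powi int m * (g ^ N) powi i"
      by (auto simp: PP_connection_set_def cyclotomic_class_def)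
    have "- z = z * (g ^ N) ^ k" unfolding k[symmetric] by simp
    also have "\<dots> = g powi int m * (g ^ N) powi (i + int k)"
      using g0 by (simp add: z power_int_add del: power_int_of_nat) simp
    finally show ?thesis
      using m by (auto simp: PP_connection_set_def cyclotomic_class_def)
  qed
  show ?thesis
    using sym[of "y - x"]
    by (auto simp: PP_edges_def cayley_edges_def doubleton_eq_iff)
qed

end

theory Submission
  imports Defs "HOL-Number_Theory.Residues" "HOL-Computational_Algebra.Polynomial"
begin

text \<open>
  Put \<open>s = p\<^sup>t\<close>, \<open>Q = s\<^sup>r = \<surd>q\<close>, let \<open>P\<close> be the group of nonzero \<open>(s + 1)\<close>-th powers and \<open>\<psi>\<close> a nontrivial
  additive character invariant under Frobenius. The map \<open>x \<mapsto> u x\<^sup>s\<^sup>+\<^sup>1\<close> is quadratic over the prime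
  field, so the square of \<open>S u = (\<Sum>x. \<psi> (u x\<^sup>s\<^sup>+\<^sup>1))\<close> is \<open>q\<close> times the size of its radical; together with
  \<open>(\<Sum>u\<noteq>0. S u) = 0\<close> and a divisibility argument for the sign this gives \<open>S u = Q\<close> for \<open>u \<noteq> 0\<close> outside
  \<open>P\<close> and \<open>S u = - s Q\<close> on \<open>P\<close>.

  As \<open>2 d\<close> divides \<open>s + 1\<close>, the connection set \<open>D\<close> and each class are unions of cosets of \<open>P\<close>. For a
  clique \<open>A\<close> the second moment of \<open>F c x = (\<Sum>a\<in>A. \<psi> (a x\<^sup>s\<^sup>+\<^sup>1 / c))\<close> over all \<open>c \<in> D\<close> and all \<open>x\<close> is a
  combination of the values \<open>S ((a - b) / c)\<close>. Comparing it with the contribution of \<open>x = 0\<close> yields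
  \<open>card A \<le> Q\<close>, and in the case of equality all \<open>F c x\<close> with \<open>x \<noteq> 0\<close> vanish. The first moment of \<open>F\<close>
  over a single class then counts the elements of \<open>A\<close> in that class.
\<close>

subsection \<open>The multiplicative group of a finite field\<close>

lemma card_field_minus_one_pos: "CARD('a::{field,finite}) - 1 > 0"
  using card_mono[of UNIV "{0, 1::'a}"] by simp

lemma power_card_minus_one:
  fixes x :: "'a::{field,finite}"
  assumes "x \<noteq> 0"
  shows "x ^ (CARD('a) - 1) = 1"
proof -
  have bij: "bij_betw ((*) x) (UNIV - {0}) (UNIV - {0})"
    by (rule bij_betw_byWitness[where f' = "\<lambda>y. y / x"]) (use assms in auto)
  have "(\<Prod>y\<in>UNIV - {0}. y) = (\<Prod>y\<in>UNIV - {0}. x * y)"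
    by (rule prod.reindex_bij_betw[OF bij, symmetric])
  also have "\<dots> = x ^ (CARD('a) - 1) * (\<Prod>y\<in>UNIV - {0}. y)"
    by (simp add: prod.distrib card_Diff_singleton)
  finally show ?thesis by (simp add: prod_zero_iff)
qed

context
  fixes g :: "'a::{field,finite}"
  assumes g: "field_primitive_root g"
begin

lemma primitive_root_nonzero: "g \<noteq> 0"
  using g by (simp add: field_primitive_root_def)

lemma primitive_root_power_mod: "g ^ (k mod (CARD('a) - 1)) = g ^ k"
proof -
  have "g ^ k = g ^ (k mod (CARD('a) - 1) + (CARD('a) - 1) * (k div (CARD('a) - 1)))"
    by simp
  also have "\<dots> = g ^ (k mod (CARD('a) - 1))"
    using power_card_minus_one[OF primitive_root_nonzero]
    by (simp only: power_add power_mult) simp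
  finally show ?thesis by simp
qed

lemma primitive_root_image: "(^) g ` {..<CARD('a) - 1} = UNIV - {0}"
proof
  show "(^) g ` {..<CARD('a) - 1} \<subseteq> UNIV - {0}"
    using primitive_root_nonzero by auto
  show "UNIV - {0} \<subseteq> (^) g ` {..<CARD('a) - 1}"
  proof
    fix x :: 'a assume "x \<in> UNIV - {0}"
    then obtain k where "x = g ^ k" using g by (auto simp: field_primitive_root_def)
    then have "x = g ^ (k mod (CARD('a) - 1))" by (simp only: primitive_root_power_mod)
    then show "x \<in> (^) g ` {..<CARD('a) - 1}" using card_field_minus_one_pos[where 'a = 'a] by auto
  qed
qed

lemma primitive_root_inj: "inj_on ((^) g) {..<CARD('a) - 1}"
proof (rule eq_card_imp_inj_on)
  show "card ((^) g ` {..<CARD('a) - 1}) = card {..<CARD('a) - 1}"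
    unfolding primitive_root_image by (simp add: card_Diff_singleton)
qed simp

lemma primitive_root_power_eq_one_iff: "g ^ k = 1 \<longleftrightarrow> CARD('a) - 1 dvd k"
proof
  assume "g ^ k = 1"
  then have "g ^ (k mod (CARD('a) - 1)) = g ^ 0" by (simp only: primitive_root_power_mod power_0)
  then have "k mod (CARD('a) - 1) = 0"
    using card_field_minus_one_pos[where 'a = 'a] by (intro inj_onD[OF primitive_root_inj]) auto
  then show "CARD('a) - 1 dvd k" by auto
next
  assume "CARD('a) - 1 dvd k"
  then show "g ^ k = 1"
    using power_card_minus_one[OF primitive_root_nonzero] by (auto simp only: dvd_def power_mult power_one)
qed

text \<open>For \<open>x = g ^ k\<close>, the equation \<open>x ^ e = 1\<close> says that the group
  order \<open>m * e\<close> divides \<open>k * e\<close>, hence that \<open>m\<close> divides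
  \<open>k\<close>. The other direction is Fermat's theorem for a root \<open>z\<close>.\<close>

lemma is_power_iff:
  fixes x :: 'a
  assumes n: "CARD('a) - 1 = m * e" and x: "x \<noteq> 0"
  shows "(\<exists>z. x = z ^ m) \<longleftrightarrow> x ^ e = 1"
proof
  assume "\<exists>z. x = z ^ m"
  then obtain z where z: "x = z ^ m" by blast
  have "m > 0" using n card_field_minus_one_pos[where 'a = 'a] by (intro Nat.gr0I) auto
  with z x have "z \<noteq> 0" by (auto simp: power_0_left)
  then show "x ^ e = 1" 
    using power_card_minus_one[of z] unfolding z n power_mult by simp
next
  assume xe: "x ^ e = 1"
  obtain k where k: "x = g ^ k" using g x by (auto simp: field_primitive_root_def)
  have "m * e dvd k * e"
    using xe primitive_root_power_eq_one_iff[of "k * e"] n by (simp add: k power_mult)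
  moreover have "e > 0" using n card_field_minus_one_pos[where 'a = 'a] by (intro Nat.gr0I) auto
  ultimately have "m dvd k" by simp
  then show "\<exists>z. x = z ^ m" by (auto simp: k power_mult mult.commute[of m] elim!: dvdE)
qed

lemma card_roots_of_one:
  assumes n: "CARD('a) - 1 = m * e"
  shows "card {x::'a. x ^ m = 1} = m"
proof -
  have m: "m > 0" and e: "e > 0" 
    using n card_field_minus_one_pos[where 'a = 'a] by (auto intro!: Nat.gr0I)
  have "{x::'a. x ^ m = 1} = (\<lambda>i. g ^ (e * i)) ` {..<m}"
  proof (intro equalityI subsetI)
    fix x :: 'a assume "x \<in> {x. x ^ m = 1}"
    then have xm: "x ^ m = 1" by simp
    with m have x: "x \<in> UNIV - {0}" by (auto simp: power_0_left)
    then obtain k where k: "x = g ^ k" "k < m * e"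
      unfolding primitive_root_image[symmetric] n by auto
    have "e * m dvd k * m"
      using xm primitive_root_power_eq_one_iff[of "k * m"] n by (simp add: k power_mult mult_ac)
    then have "e dvd k" using m by simp
    then obtain i where "k = e * i" ..
    then show "x \<in> (\<lambda>i. g ^ (e * i)) ` {..<m}" using k by auto
  next
    fix x assume "x \<in> (\<lambda>i. g ^ (e * i)) ` {..<m}"
    then obtain i where "x = g ^ (e * i)" by auto
    moreover have "g ^ (e * i * m) = 1"
      unfolding primitive_root_power_eq_one_iff n by simp
    ultimately show "x \<in> {x. x ^ m = 1}" by (simp add: power_mult)
  qed
  moreover have "inj_on (\<lambda>i. g ^ (e * i)) {..<m}"
  proof (rule inj_onI)
    fix i j assume ij: "i \<in> {..<m}" "j \<in> {..<m}" "g ^ (e * i) = g ^ (e * j)"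
    then have "e * i < m * e" "e * j < m * e" using e by (simp_all add: mult.commute)
    then have "e * i = e * j" using ij(3) n by (intro inj_onD[OF primitive_root_inj]) auto
    then show "i = j" using e by simp
  qed
  ultimately show ?thesis by (simp add: card_image)
qed

lemma card_roots_of_power:
  fixes b :: 'a
  assumes n: "CARD('a) - 1 = m * e" and b: "b \<noteq> 0"
  shows "card {x. x ^ m = b ^ m} = m"
proof -
  have "{x. x ^ m = b ^ m} = (*) b ` {x. x ^ m = 1}"
  proof (intro equalityI subsetI)
    fix x assume "x \<in> {x. x ^ m = b ^ m}"
    then have "x = b * (x / b)" "(x / b) ^ m = 1" using b by (auto simp: power_divide)
    then show "x \<in> (*) b ` {x. x ^ m = 1}" by blast
  qed (auto simp: power_mult_distrib)
  moreover have "inj_on ((*) b) {x. x ^ m = 1}" using b by (auto intro: inj_onI)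
  ultimately show ?thesis using card_roots_of_one[OF n] by (simp add: card_image)
qed

end

text \<open>The set is a disjoint union of nonempty fibres of \<open>x ^ m\<close> over nonzero
  values, and each such fibre is a coset of the \<open>m\<close>-th roots of unity, of size
  \<open>m\<close>.\<close>

lemma card_dvd_of_roots_invariant:
  fixes g :: "'a::{field,finite}" and A :: "'a set"
  assumes g: "field_primitive_root g" and n: "CARD('a) - 1 = m * e" and "0 \<notin> A"
    and inv: "\<And>a h. a \<in> A \<Longrightarrow> h ^ m = 1 \<Longrightarrow> a * h \<in> A"
  shows "m dvd card A"
proof -
  have m: "m > 0" using n card_field_minus_one_pos[where 'a = 'a] by (auto intro!: Nat.gr0I)
  define R where "R a = {x. x ^ m = a ^ m}" for a :: 'a
  have A: "A = \<Union> (R ` A)"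
  proof (intro equalityI subsetI)
    fix x assume "x \<in> \<Union> (R ` A)"
    then obtain a where a: "a \<in> A" "x ^ m = a ^ m" by (auto simp: R_def)
    with \<open>0 \<notin> A\<close> have "a \<noteq> 0" by auto
    then have "a * (x / a) \<in> A" using a by (intro inv) (auto simp: power_divide)
    with \<open>a \<noteq> 0\<close> show "x \<in> A" by simp
  qed (auto simp: R_def)
  have "m dvd card (\<Union> (R ` A))"
  proof (rule dvd_partition)
    have "card (R a) = m" if "a \<in> A" for a
      unfolding R_def using that \<open>0 \<notin> A\<close> by (intro card_roots_of_power[OF g n]) auto
    then show "\<forall>c\<in>R ` A. m dvd card c" by simp
  qed (auto simp: R_def)
  with A show ?thesis by simp
qed

subsection \<open>An additive character invariant under Frobenius\<close>

lemma CHAR_eq_of_CARD: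
  assumes "prime p" and "CARD('a::{field,finite}) = p ^ n"
  shows "CHAR('a) = p"
proof -
  have "CHAR('a) > 0" by (rule finite_imp_CHAR_pos) simp
  then have "prime CHAR('a)" by (rule prime_CHAR_semidom)
  moreover have "CHAR('a) dvd p ^ n" using CHAR_dvd_CARD[where 'a = 'a] assms by simp
  ultimately show ?thesis 

    using assms(1) primes_dvd_imp_eq prime_dvd_power by blast
qed

text \<open>The polynomial \<open>X ^ p - X\<close> has at most \<open>p\<close> roots, and the
  \<open>p\<close> distinct elements of the prime field are already roots.\<close>

lemma power_char_eq_self_iff:
  fixes x :: "'a::{field,finite}"
  assumes p: "prime p" and char: "CHAR('a) = p"
  shows "x ^ p = x \<longleftrightarrow> (\<exists>k<p. x = of_nat k)"
proof -
  define P :: "'a poly" where "P = monom 1 p - monom 1 1"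
  have p1: "p > 1" using p by (rule prime_gt_1_nat)
  have "coeff P p = 1" using p1 by (simp add: P_def)
  then have P0: "P \<noteq> 0" by auto
  have "degree P \<le> p" unfolding P_def using p1
    by (intro degree_diff_le degree_monom_le[THEN order_trans]) auto
  then have "card {x. poly P x = 0} \<le> p" using card_poly_roots_bound[OF P0] by simp
  then have le: "card {x::'a. x ^ p = x} \<le> p" by (simp add: P_def poly_monom)
  have inj: "inj_on (of_nat :: nat \<Rightarrow> 'a) {..<p}"
  proof (rule linorder_inj_onI')
    fix i j assume ij: "i \<in> {..<p}" "j \<in> {..<p}" "i < j"
    then have "\<not> p dvd (j - i)" by (auto dest: dvd_imp_le)
    then have "(of_nat (j - i) :: 'a) \<noteq> 0" using char by (simp add: of_nat_eq_0_iff_char_dvd)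
    then show "(of_nat i :: 'a) \<noteq> of_nat j" using ij by (simp add: of_nat_diff)
  qed
  have frob: "(of_nat k :: 'a) ^ p = of_nat k" for k
  proof (induction k)
    case (Suc k)
    have "(1 + of_nat k :: 'a) ^ p = 1 ^ p + of_nat k ^ p"
      by (rule freshmans_dream) (simp_all add: p char)
    with Suc show ?case by simp
  qed (use p1 in simp)
  have "of_nat ` {..<p} \<subseteq> {x::'a. x ^ p = x}" using frob by auto
  moreover have "card {x::'a. x ^ p = x} \<le> card ((of_nat :: nat \<Rightarrow> 'a) ` {..<p})"
    using le inj by (simp add: card_image)
  ultimately have "(of_nat :: nat \<Rightarrow> 'a) ` {..<p} = {x::'a. x ^ p = x}"
    by (intro card_seteq) auto
  then show ?thesis by (auto simp: set_eq_iff image_iff)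
qed

text \<open>The character is a primitive \<open>p\<close>-th root of unity raised to the absolute
  trace. Frobenius permutes the terms of the trace cyclically, which gives the invariance.\<close>

lemma exists_frobenius_invariant_character:
  assumes p: "prime p" and card: "CARD('a::{field,finite}) = p ^ n" and n: "n > 0"
  obtains \<psi> :: "'a::{field,finite} \<Rightarrow> complex" where
    "\<And>x y. \<psi> (x + y) = \<psi> x * \<psi> y" "\<And>x. \<psi> (x ^ p) = \<psi> x"
    "\<And>x. \<psi> x ^ p = 1" "\<exists>x. \<psi> x \<noteq> 1"
proof -
  have char: "CHAR('a) = p" using CHAR_eq_of_CARD[OF p card] .
  have p1: "p > 1" using p by (rule prime_gt_1_nat)
  have fermat: "x ^ (p ^ n) = x" for x :: 'a
  proof (cases "x = 0")
    case False
    have "x ^ Suc (CARD('a) - 1) = x"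
      unfolding power_Suc2 power_card_minus_one[OF False] by simp
    moreover have "Suc (CARD('a) - 1) = p ^ n" using p1 by (simp add: card)
    ultimately show ?thesis by simp
  qed (use p1 in simp)
  define Tr where "Tr x = (\<Sum>i<n. x ^ (p ^ i))" for x :: 'a
  have Tr_add: "Tr (x + y) = Tr x + Tr y" for x y
  proof -
    have "(x + y) ^ (p ^ i) = x ^ (p ^ i) + y ^ (p ^ i)" for i
      by (rule freshmans_dream') (simp_all add: p char)
    then show ?thesis by (simp add: Tr_def sum.distrib)
  qed
  have shift: "Tr (x ^ p) = Tr x" for x
  proof -
    obtain k where k: "n = Suc k" using n by (cases n) auto
    have "Tr (x ^ p) = (\<Sum>i<n. x ^ (p ^ Suc i))" by (simp add: Tr_def power_mult[symmetric])
    also have "\<dots> = (\<Sum>i<k. x ^ (p ^ Suc i)) + x" using fermat[of x] by (simp add: k)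
    also have "\<dots> = Tr x" unfolding Tr_def k sum.lessThan_Suc_shift by (simp add: add.commute)
    finally show ?thesis .
  qed
  have Tr_fixed: "Tr x ^ p = Tr x" for x
  proof -
    have "Tr x ^ p = (\<Sum>i<n. (x ^ (p ^ i)) ^ p)"
      unfolding Tr_def by (rule freshmans_dream_sum) (simp_all add: p char)
    also have "\<dots> = Tr (x ^ p)" by (simp add: Tr_def power_mult[symmetric] mult.commute)
    finally have "Tr x ^ p = Tr (x ^ p)" .
    then show ?thesis by (simp add: shift)
  qed
  \<comment> \<open>\<open>k x\<close> is the representative of the trace in \<open>{..<p}\<close>.
    It is additive only modulo \<open>p\<close>, which suffices because
    \<open>\<omega> ^ p = 1\<close>.\<close>
  define k where "k x = (SOME j. j < p \<and> Tr x = of_nat j)" for x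
  have k: "k x < p \<and> Tr x = of_nat (k x)" for x
    unfolding k_def by (rule someI_ex) (use Tr_fixed power_char_eq_self_iff[OF p char] in blast)
  define \<omega> where "\<omega> = cis (2 * pi / real p)"
  have \<omega>_p: "\<omega> ^ p = 1" using p1 by (simp add: \<omega>_def DeMoivre)
  have \<omega>_cong: "\<omega> ^ i = \<omega> ^ j" if "(of_nat i :: 'a) = of_nat j" for i j
  proof -
    have *: "\<omega> ^ i = \<omega> ^ j" if "(of_nat i :: 'a) = of_nat j" "i \<le> j" for i j
    proof -
      have "(of_nat (j - i) :: 'a) = 0" using that by (simp add: of_nat_diff)
      then have "p dvd j - i" using char by (simp add: of_nat_eq_0_iff_char_dvd)
      then obtain l where "j - i = p * l" ..
      with that(2) have "j = i + p * l" by linarith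
      then show ?thesis by (simp add: power_add power_mult \<omega>_p)
    qed
    show ?thesis
    proof (cases "i \<le> j")
      case False
      then show ?thesis by (intro *[OF that[symmetric], symmetric]) simp
    qed (rule *[OF that])
  qed
  define \<psi> where "\<psi> x = \<omega> ^ k x" for x
  have "\<psi> (x + y) = \<psi> x * \<psi> y" for x y
    unfolding \<psi>_def power_add[symmetric] by (rule \<omega>_cong) (use k[of x] k[of y] k[of "x + y"] Tr_add[of x y] in simp)
  moreover have "\<psi> (x ^ p) = \<psi> x" for x
    unfolding \<psi>_def by (rule \<omega>_cong) (use k[of x] k[of "x ^ p"] shift[of x] in simp)
  moreover have "\<psi> x ^ p = 1" for x
    unfolding \<psi>_def by (simp add: power_mult[symmetric] mult.commute[of _ p]) (simp add: power_mult \<omega>_p)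
  moreover have "\<exists>x. \<psi> x \<noteq> 1"
  proof -
    \<comment> \<open>This is the trace as a polynomial. It is nonzero of degree below the size of
      the field, so some element has nonzero trace.\<close>
    define P :: "'a poly" where "P = (\<Sum>i<n. monom 1 (p ^ i))"
    have "coeff P (p ^ 0) = (\<Sum>i<n. if i = 0 then 1 else 0)"
      unfolding P_def coeff_sum using p1 by (intro sum.cong) (auto simp: power_eq_1_iff)
    also have "\<dots> = 1" using n by simp
    finally have P0: "P \<noteq> 0" by auto
    have "degree P \<le> p ^ (n - 1)" unfolding P_def
      by (intro degree_sum_le degree_monom_le[THEN order_trans])
         (use p1 in \<open>auto intro!: power_increasing\<close>)
    also have "\<dots> < p ^ n" using p1 n by (intro power_strict_increasing) auto
    finally have "card {x. poly P x = 0} < CARD('a)"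
      using card_poly_roots_bound[OF P0] card by simp
    then have "{x. poly P x = 0} \<noteq> UNIV" by auto
    then obtain x where "Tr x \<noteq> 0" by (auto simp: P_def Tr_def poly_sum poly_monom)
    then have kx: "0 < k x" "k x < p" using k[of x] by (auto intro: Nat.gr0I)
    have "\<omega> ^ k x \<noteq> 1"
    proof
      assume "\<omega> ^ k x = 1"
      then have "cis (2 * pi * real (k x) / real p) = cis (2 * pi * real 0 / real p)"
        by (simp add: \<omega>_def DeMoivre mult_ac)
      then have "k x = 0"
        using kx p1 by (intro inj_onD[OF bij_betw_imp_inj_on[OF bij_betw_roots_unity[of p]]]) auto
      then show False using kx by simp
    qed
    then show ?thesis by (auto simp: \<psi>_def)
  qed
  ultimately show ?thesis by (rule that)
qed

subsection \<open>Monomial character sums of semiprimitive exponent\<close>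

text \<open>The parameter \<open>d\<close> is absent: the sums depend only on
  \<open>s = p ^ t\<close>, and the divisibility of \<open>s + 1\<close> by \<open>2 * d\<close>
  enters when the classes are compared with \<open>P\<close>.\<close>

locale semiprimitive_character =
  fixes p t r :: nat and g :: "'a::{field,finite}" and \<psi> :: "'a \<Rightarrow> complex"
  assumes prime_p: "prime p" and odd_p: "odd p" and t_pos: "t > 0"
    and even_r: "even r" and r_pos: "r > 0"
    and card_field_p: "CARD('a) = p ^ (2 * r * t)"
    and g: "field_primitive_root g"
    and \<psi>_add: "\<psi> (x + y) = \<psi> x * \<psi> y"
    and \<psi>_frob: "\<psi> (x ^ p) = \<psi> x"
    and \<psi>_root: "\<psi> x ^ p = 1"
    and \<psi>_nontrivial: "\<exists>x. \<psi> x \<noteq> 1"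
begin

section \<open>Arithmetic of \<open>s\<close>, \<open>Q\<close> and the order of the unit
  group\<close>

definition s :: nat where "s = p ^ t"

definition Q :: nat where "Q = s ^ r"

lemma p_ge_3: "p \<ge> 3"
  using prime_p odd_p by (metis One_nat_def Suc_1 dvd_refl not_less_eq_eq numeral_3_eq_3 order_antisym prime_ge_2_nat)

lemma s_ge_3: "s \<ge> 3"
proof -
  have "p ^ 1 \<le> p ^ t" using t_pos p_ge_3 by (intro power_increasing) auto
  then show ?thesis using p_ge_3 by (simp add: s_def)
qed

lemma card_field: "CARD('a) = Q\<^sup>2"
  unfolding card_field_p Q_def s_def power_mult[symmetric] by (simp add: mult_ac)

lemma Q_pos: "Q > 0"
  using s_ge_3 by (simp add: Q_def)

lemma char_p: "CHAR('a) = p"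
  using prime_p card_field_p by (rule CHAR_eq_of_CARD)

text \<open>Evenness of \<open>r\<close> enters here: it makes \<open>Q\<close> a power of
  \<open>s ^ 2\<close>.\<close>

lemma Q_cong_one: "(int s + 1) * (int s - 1) dvd int Q - 1"
proof -
  obtain k where k: "r = 2 * k" using even_r by auto
  have "int Q - 1 = ((int s)\<^sup>2) ^ k - 1" by (simp only: Q_def) (simp add: k power_mult)
  also have "(int s)\<^sup>2 - 1 dvd ((int s)\<^sup>2) ^ k - 1"
    unfolding power_diff_1_eq[of "(int s)\<^sup>2" k] by simp
  finally show ?thesis by (simp add: power2_eq_square algebra_simps)
qed

lemma p_minus_one_dvd: "p - 1 dvd s - 1"
proof -
  have "int p - 1 dvd int p ^ t - 1" unfolding power_diff_1_eq by simp
  then have "int (p - 1) dvd int (s - 1)"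
    using p_ge_3 s_ge_3 by (simp add: of_nat_diff s_def)
  then show ?thesis by simp
qed

text \<open>In \<open>(Q - 1) * (Q + 1)\<close> the first factor supplies \<open>s ^ 2 - 1\<close>
  and the second, being even, the extra 2. That 2 is what makes \<open>- 1\<close> a power of
  exponent \<open>s ^ 2 - 1\<close>.\<close>

lemma card_units_factor:
  obtains c where "CARD('a) - 1 = (s + 1) * ((s - 1) * (2 * c))"
proof -
  obtain a where a: "int Q - 1 = (int s + 1) * (int s - 1) * a"
    using Q_cong_one by (elim dvdE)
  have "odd Q" using odd_p by (simp add: Q_def s_def)
  then have "even (int Q + 1)" by simp
  then obtain b where b: "int Q + 1 = 2 * b" by (elim dvdE)
  \<comment> \<open>The cofactors are integers; their signs must be known before \<open>nat\<close>
    can be applied to the product.\<close>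
  have a0: "a \<ge> 0"
  proof (rule ccontr)
    assume "\<not> a \<ge> 0"
    then have "(int s + 1) * (int s - 1) * a < 0" using s_ge_3 by (intro mult_pos_neg mult_pos_pos) auto
    then show False using a Q_pos by simp
  qed
  have b0: "b \<ge> 0" using b by simp
  have "int (CARD('a) - 1) = (int Q - 1) * (int Q + 1)"
    using Q_pos by (simp add: card_field of_nat_diff power2_eq_square algebra_simps)
  also have "\<dots> = int ((s + 1) * ((s - 1) * (2 * nat (a * b))))"
    unfolding a b using a0 b0 s_ge_3 by (simp add: of_nat_diff algebra_simps)
  finally show ?thesis using that by (simp only: of_nat_eq_iff)
qed

definition e :: nat where "e = (CARD('a) - 1) div (s + 1)"

lemma card_units: "CARD('a) - 1 = (s + 1) * e"
  unfolding e_def by (metis card_units_factor dvd_mult_div_cancel dvd_triv_left)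

lemma s_minus_one_dvd_e: "2 * (s - 1) dvd e"
proof -
  obtain c where "CARD('a) - 1 = (s + 1) * ((s - 1) * (2 * c))" by (rule card_units_factor)
  then have "(s + 1) * e = (s + 1) * ((s - 1) * (2 * c))" using card_units by simp
  then have "e = (s - 1) * (2 * c)" by (simp only: mult_cancel1) simp
  then show ?thesis by simp
qed

section \<open>The group of nonzero \<open>(s + 1)\<close>-th powers\<close>

definition P :: "'a set" where "P = {x. x \<noteq> 0 \<and> (\<exists>z. x = z ^ (s + 1))}"

lemma P_iff: "x \<in> P \<longleftrightarrow> x ^ e = 1"
proof (cases "x = 0")
  case True
  have "e > 0" using card_units card_field_minus_one_pos[where 'a = 'a] by (intro Nat.gr0I) auto
  then show ?thesis using True by (simp add: P_def power_0_left)
qed (use is_power_iff[OF g card_units, of x] in \<open>simp add: P_def\<close>)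

lemma card_P: "card P = e"
proof -
  have "P = {x. x ^ e = 1}" using P_iff by blast
  then show ?thesis using card_roots_of_one[OF g trans[OF card_units mult.commute]] by simp
qed

lemma P_of_root: "x ^ m = 1 \<Longrightarrow> m dvd e \<Longrightarrow> x \<in> P"
  unfolding P_iff by (auto simp: power_mult elim!: dvdE)

lemma one_in_P: "1 \<in> P" and P_mult: "x \<in> P \<Longrightarrow> y \<in> P \<Longrightarrow> x * y \<in> P"
  and P_divide: "x \<in> P \<Longrightarrow> y \<in> P \<Longrightarrow> x / y \<in> P"
  by (simp_all add: P_iff power_mult_distrib power_divide)

lemma power_in_P: "z \<noteq> 0 \<Longrightarrow> z ^ (s + 1) \<in> P"
  by (auto simp: P_def)

lemma zero_notin_P: "0 \<notin> P"
  by (simp add: P_def)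

text \<open>Since \<open>e\<close> is even, \<open>- 1\<close> is an \<open>e\<close>-th root of
  unity. This is what makes \<open>S u\<close> real.\<close>

lemma minus_one_in_P: "- 1 \<in> P"
proof (rule P_of_root)
  show "(2::nat) dvd e" using s_minus_one_dvd_e by (rule dvd_mult_left)
qed simp

section \<open>Values and orthogonality of the character\<close>

lemma \<psi>_nonzero: "\<psi> x \<noteq> 0"
  using \<psi>_root[of x] prime_gt_0_nat[OF prime_p] by (auto simp: power_0_left)

lemma \<psi>_zero: "\<psi> 0 = 1"
  using \<psi>_add[of 0 0] \<psi>_nonzero[of 0] by simp

lemma norm_\<psi>: "norm (\<psi> x) = 1"
proof -
  have "norm (\<psi> x) ^ p = 1" using \<psi>_root[of x] by (simp add: norm_power[symmetric])
  then show ?thesis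
    using prime_gt_0_nat[OF prime_p] power_eq_imp_eq_base[of "norm (\<psi> x)" p 1] by simp
qed

lemma cnj_\<psi>: "cnj (\<psi> x) = \<psi> (- x)"
proof -
  have "\<psi> x * \<psi> (- x) = 1" using \<psi>_add[of x "- x"] \<psi>_zero by simp
  moreover have "\<psi> x * cnj (\<psi> x) = 1" by (simp add: complex_norm_square[symmetric] norm_\<psi>)
  ultimately show ?thesis using \<psi>_nonzero[of x] by (metis mult_left_cancel)
qed

lemma \<psi>_of_nat_mult: "\<psi> (of_nat k * x) = \<psi> x ^ k"
  by (induction k) (simp_all add: \<psi>_zero \<psi>_add algebra_simps)

lemma \<psi>_power_s: "\<psi> (x ^ s) = \<psi> x"
proof -
  have "\<psi> (x ^ (p ^ i)) = \<psi> x" for i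
    by (induction i) (simp_all add: \<psi>_frob power_mult mult.commute[of p])
  then show ?thesis by (simp add: s_def)
qed

text \<open>For nonzero \<open>a\<close>, translating \<open>x\<close> by \<open>y / a\<close>
  multiplies the sum by \<open>\<psi> y\<close>, and \<open>y\<close> can be chosen with
  \<open>\<psi> y \<noteq> 1\<close>.\<close>

lemma sum_\<psi>: "(\<Sum>x\<in>UNIV. \<psi> (a * x)) = (if a = 0 then of_nat CARD('a) else 0)"
proof (cases "a = 0")
  case False
  obtain y where y: "\<psi> y \<noteq> 1" using \<psi>_nontrivial by blast
  have "(\<Sum>x\<in>UNIV. \<psi> (a * x)) = (\<Sum>x\<in>UNIV. \<psi> (a * (x + y / a)))"
    by (rule sum.reindex_bij_witness[of _ "\<lambda>x. x + y / a" "\<lambda>x. x - y / a"]) auto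
  also have "\<dots> = \<psi> y * (\<Sum>x\<in>UNIV. \<psi> (a * x))"
    using False by (simp add: distrib_left \<psi>_add sum_distrib_left mult.commute)
  finally have "(1 - \<psi> y) * (\<Sum>x\<in>UNIV. \<psi> (a * x)) = 0" by (simp add: algebra_simps)
  with y False show ?thesis by simp
qed (simp add: \<psi>_zero)

lemma add_power_s: "(x + y :: 'a) ^ s = x ^ s + y ^ s"
  by (rule freshmans_dream') (simp_all add: prime_p char_p s_def)

lemma minus_power_s: "(- x :: 'a) ^ s = - (x ^ s)"
proof -
  have "odd s" using odd_p by (simp add: s_def)
  then show ?thesis by simp
qed

lemma bij_power_s: "bij (\<lambda>x::'a. x ^ s)"
proof -
  have "inj (\<lambda>x::'a. x ^ s)"
  proof (rule injI)
    fix x y :: 'a assume "x ^ s = y ^ s"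
    then have "(x + - y) ^ s = 0" by (simp only: add_power_s minus_power_s) simp
    then show "x = y" by simp
  qed
  then show ?thesis by (simp add: bij_def finite_UNIV_inj_surj)
qed

section \<open>The quadratic sums and their absolute values\<close>

definition S :: "'a \<Rightarrow> complex" where "S u = (\<Sum>x\<in>UNIV. \<psi> (u * x ^ (s + 1)))"

text \<open>This is the kernel of the bilinear form attached to \<open>u * x ^ (s + 1)\<close>: the
  \<open>h\<close> for which \<open>\<psi> (u * (y ^ s * h) + u * (h ^ s * y))\<close> is 1 for all
  \<open>y\<close>. Raising the second summand to the power \<open>s\<close>, which \<psi> does not
  notice, turns this into one equation in \<open>h\<close>.\<close>

definition radical :: "'a \<Rightarrow> 'a set" where "radical u = {h. u * h + u ^ s * h ^ s\<^sup>2 = 0}"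

text \<open>The value \<open>v = u * h ^ (s + 1)\<close> satisfies \<open>v + v ^ s = 0\<close>, so
  invariance under Frobenius gives \<open>\<psi> v ^ 2 = 1\<close>. As \<open>\<psi> v\<close> is
  also a \<open>p\<close>-th root of unity with \<open>p\<close> odd, it is 1.\<close>

lemma \<psi>_radical:
  assumes "h \<in> radical u"
  shows "\<psi> (u * h ^ (s + 1)) = 1"
proof -
  define v where "v = u * h ^ (s + 1)"
  have "v + v ^ s = h ^ s * (u * h + u ^ s * h ^ s\<^sup>2)"
    by (simp add: v_def power_mult_distrib power_mult[symmetric] power_add[symmetric] algebra_simps
        power2_eq_square)
  also have "\<dots> = 0" using assms by (simp add: radical_def)
  finally have "\<psi> v * \<psi> (v ^ s) = 1" by (simp add: \<psi>_add[symmetric] \<psi>_zero)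
  then have sq: "\<psi> v ^ 2 = 1" by (simp add: \<psi>_power_s power2_eq_square)
  obtain k where "p = 2 * k + 1" using odd_p by (elim oddE)
  then have "\<psi> v ^ p = \<psi> v" by (simp add: power_mult sq)
  then show ?thesis by (simp add: \<psi>_root v_def)
qed

text \<open>Substituting \<open>x = y + h\<close> leaves a factor depending on \<open>h\<close>
  alone and a sum over \<open>y\<close> of the bilinear terms. By orthogonality that sum vanishes
  unless \<open>h\<close> lies in the radical, where the remaining factor is 1.\<close>

lemma S_times_cnj: "S u * cnj (S u) = of_nat (CARD('a) * card (radical u))"
proof -
  have inner: "(\<Sum>y\<in>UNIV. \<psi> (u * (y ^ s * h) + u * (h ^ s * y)))
      = (if h \<in> radical u then of_nat CARD('a) else 0)" for h
  proof -
    have "\<psi> (u * (y ^ s * h) + u * (h ^ s * y)) = \<psi> ((u * h + u ^ s * h ^ s\<^sup>2) * y ^ s)" for y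
    proof -
      have "\<psi> (u * (h ^ s * y)) = \<psi> ((u * (h ^ s * y)) ^ s)" by (rule \<psi>_power_s[symmetric])
      also have "(u * (h ^ s * y)) ^ s = u ^ s * h ^ s\<^sup>2 * y ^ s"
        by (simp add: power_mult_distrib power_mult[symmetric] power2_eq_square mult_ac)
      finally have "\<psi> (u * (h ^ s * y)) = \<psi> (u ^ s * h ^ s\<^sup>2 * y ^ s)" .
      moreover have "u * (y ^ s * h) = u * h * y ^ s" by (simp add: mult_ac)
      ultimately show ?thesis by (simp only: \<psi>_add distrib_right)
    qed
    then have "(\<Sum>y\<in>UNIV. \<psi> (u * (y ^ s * h) + u * (h ^ s * y)))
        = (\<Sum>y\<in>UNIV. \<psi> ((u * h + u ^ s * h ^ s\<^sup>2) * y ^ s))" by simp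
    also have "\<dots> = (\<Sum>y\<in>UNIV. \<psi> ((u * h + u ^ s * h ^ s\<^sup>2) * y))"
      by (rule sum.reindex_bij_betw[OF bij_power_s])
    finally show ?thesis by (simp add: sum_\<psi> radical_def)
  qed
  have expand: "u * (y + h) ^ (s + 1) + - (u * y ^ (s + 1))
      = u * h ^ (s + 1) + (u * (y ^ s * h) + u * (h ^ s * y))" for y h
    by (simp add: add_power_s algebra_simps)
  have "S u * cnj (S u) = (\<Sum>y\<in>UNIV. \<Sum>x\<in>UNIV. \<psi> (u * x ^ (s + 1)) * cnj (\<psi> (u * y ^ (s + 1))))"
    by (simp add: S_def sum_product cnj_sum) (rule sum.swap)
  also have "\<dots> = (\<Sum>y\<in>UNIV. \<Sum>x\<in>UNIV. \<psi> (u * x ^ (s + 1) + - (u * y ^ (s + 1))))"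
    by (simp only: cnj_\<psi> \<psi>_add)
  also have "\<dots> = (\<Sum>y\<in>UNIV. \<Sum>h\<in>UNIV. \<psi> (u * (y + h) ^ (s + 1) + - (u * y ^ (s + 1))))"
  proof (rule sum.cong[OF refl])
    fix y
    show "(\<Sum>x\<in>UNIV. \<psi> (u * x ^ (s + 1) + - (u * y ^ (s + 1))))
        = (\<Sum>h\<in>UNIV. \<psi> (u * (y + h) ^ (s + 1) + - (u * y ^ (s + 1))))"
      by (rule sum.reindex_bij_witness[of _ "\<lambda>h. y + h" "\<lambda>x. x - y"]) auto
  qed
  also have "\<dots> = (\<Sum>h\<in>UNIV. \<Sum>y\<in>UNIV. \<psi> (u * (y + h) ^ (s + 1) + - (u * y ^ (s + 1))))"
    by (rule sum.swap)
  also have "\<dots> = (\<Sum>h\<in>UNIV. \<psi> (u * h ^ (s + 1)) * (if h \<in> radical u then of_nat CARD('a) else 0))"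
    unfolding expand unfolding \<psi>_add[of "u * _ ^ (s + 1)"] sum_distrib_left[symmetric] inner ..
  also have "\<dots> = (\<Sum>h\<in>UNIV. if h \<in> radical u then of_nat CARD('a) else 0)"
    by (intro sum.cong refl) (use \<psi>_radical in auto)
  also have "\<dots> = of_nat (CARD('a) * card (radical u))"
    by (simp add: sum.If_cases mult.commute)
  finally show ?thesis .
qed

text \<open>An element of \<open>P\<close> is some \<open>z ^ (s + 1)\<close> and is absorbed by
  rescaling \<open>x\<close> by \<open>z\<close>.\<close>

lemma S_mult_P:
  assumes "w \<in> P"
  shows "S (u * w) = S u"
proof -
  obtain z where z: "w = z ^ (s + 1)" and "z \<noteq> 0" using assms by (auto simp: P_def)
  have "S (u * w) = (\<Sum>x\<in>UNIV. \<psi> (u * (z * x) ^ (s + 1)))"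
    unfolding S_def z power_mult_distrib by (simp only: mult.assoc)
  also have "\<dots> = S u" unfolding S_def
    by (rule sum.reindex_bij_witness[of _ "\<lambda>x. x / z" "\<lambda>x. z * x"]) (use \<open>z \<noteq> 0\<close> in auto)
  finally show ?thesis .
qed

lemma cnj_S: "cnj (S u) = S u"
proof -
  have "cnj (S u) = S (u * - 1)" by (simp add: S_def cnj_sum cnj_\<psi>)
  then show ?thesis by (simp only: S_mult_P[OF minus_one_in_P])
qed

lemma S_eq_Re: "S u = of_real (Re (S u))"
  using cnj_S by (metis Reals_cnj_iff of_real_Re)

lemma Re_S_square: "(Re (S u))\<^sup>2 = real (CARD('a) * card (radical u))"
proof -
  have "complex_of_real ((Re (S u))\<^sup>2) = S u * cnj (S u)"
    unfolding cnj_S by (simp add: power2_eq_square flip: S_eq_Re)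
  also have "\<dots> = complex_of_real (real (CARD('a) * card (radical u)))"
    unfolding S_times_cnj by simp
  finally show ?thesis by (simp only: of_real_eq_iff)
qed

text \<open>Nonzero elements of the radical solve \<open>u ^ (s - 1) * h ^ (s^2 - 1) = - 1\<close>.
  For \<open>u\<close> in \<open>P\<close> this reduces to extracting an \<open>(s^2 - 1)\<close>-th
  root of a known power; conversely, any solution forces \<open>u\<close> into
  \<open>P\<close>.\<close>

lemma card_radical:
  assumes "u \<noteq> 0"
  shows "card (radical u) = (if u \<in> P then s\<^sup>2 else 1)"
proof -
  define m where "m = s\<^sup>2 - 1"
  have m: "m = (s + 1) * (s - 1)" and ss: "s\<^sup>2 = Suc m" and m0: "m > 0"
    using mult_mono[OF s_ge_3 s_ge_3] by (simp_all add: m_def power2_eq_square algebra_simps)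
  have s1: "s = Suc (s - 1)" using s_ge_3 by simp
  obtain c where c: "CARD('a) - 1 = m * (2 * c)"
    using card_units_factor by (metis m mult.assoc)
  \<comment> \<open>The complementary exponent \<open>2 * c\<close> is even, so \<open>- 1\<close>
    passes the power criterion.\<close>
  obtain z where z: "(- 1 :: 'a) = z ^ m"
    using is_power_iff[OF g c, of "- 1"] by (auto simp: power_mult)
  have z0: "z \<noteq> 0" using z m0 by (auto simp: power_0_left)
  define R where "R = {h. u ^ (s - 1) * h ^ m = - 1}"
  have factor: "u * h + u ^ s * h ^ s\<^sup>2 = u * h * (1 + u ^ (s - 1) * h ^ m)" for h
    by (subst s1, subst ss) (simp add: algebra_simps)
  have rad: "radical u = insert 0 R"
    unfolding radical_def factor R_def using assms by (auto simp: add_eq_0_iff)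
  have "0 \<notin> R" using m0 by (simp add: R_def zero_power)
  then have card: "card (radical u) = Suc (card R)" by (simp add: rad)
  show ?thesis
  proof (cases "u \<in> P")
    case True
    then obtain v where v: "u = v ^ (s + 1)" "v \<noteq> 0" by (auto simp: P_def)
    have "u ^ (s - 1) * h ^ m = (v * h) ^ m" for h
      by (simp only: v(1) m power_mult_distrib power_mult)
    then have "R = {h. (v * h) ^ m = z ^ m}" by (simp add: R_def z)
    also have "\<dots> = {h. h ^ m = (z / v) ^ m}"
      using v(2) by (auto simp: power_mult_distrib power_divide field_simps)
    finally have "card R = m"
      using card_roots_of_power[OF g c, of "z / v"] z0 v(2) by simp
    then show ?thesis using card True ss by simp
  next
    case False
    have "R = {}"
    proof (rule ccontr)
      assume "R \<noteq> {}"
      then obtain h where h: "u ^ (s - 1) * h ^ m = z ^ m" by (auto simp: R_def z)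
      have h0: "h \<noteq> 0" using h z0 m0 by (auto simp: power_0_left)
      \<comment> \<open>A solution makes \<open>u\<close> times an \<open>(s + 1)\<close>-th power
        an \<open>(s - 1)\<close>-th root of unity. Such roots lie in \<open>P\<close> because
        \<open>s - 1\<close> divides \<open>e\<close>.\<close>
      have "(u * (h / z) ^ (s + 1)) ^ (s - 1) = u ^ (s - 1) * (h / z) ^ m"
        by (simp only: m power_mult_distrib power_mult)
      also have "\<dots> = 1" using h z0 by (simp add: power_divide)
      finally have "u * (h / z) ^ (s + 1) \<in> P"
        by (rule P_of_root) (use s_minus_one_dvd_e dvd_mult_right in blast)
      then have "u * (h / z) ^ (s + 1) / (h / z) ^ (s + 1) \<in> P"
        using h0 z0 by (intro P_divide power_in_P) auto
      then show False using False h0 z0 by simp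
    qed
    then show ?thesis using card False by simp
  qed
qed


lemma Re_S_cases:
  assumes "u \<noteq> 0"
  shows "\<bar>Re (S u)\<bar> = (if u \<in> P then real (s * Q) else real Q)"
proof -
  have "(Re (S u))\<^sup>2 = (if u \<in> P then real (s * Q) else real Q)\<^sup>2"
    unfolding Re_S_square card_radical[OF assms] card_field
    by (simp add: power_mult_distrib mult.commute)
  then show ?thesis unfolding power2_eq_iff by (auto split: if_splits)
qed

lemma S_zero: "S 0 = of_nat CARD('a)"
  by (simp add: S_def \<psi>_zero)

text \<open>Summing over all \<open>u\<close> first leaves only the term \<open>x = 0\<close>, which
  is exactly the contribution of \<open>u = 0\<close>.\<close>

lemma sum_S_nonzero: "(\<Sum>u\<in>UNIV - {0}. S u) = 0"
proof -
  have "(\<Sum>u\<in>UNIV. S u) = (\<Sum>x\<in>UNIV. \<Sum>u\<in>UNIV. \<psi> (x ^ (s + 1) * u))"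
    unfolding S_def by (subst sum.swap) (simp only: mult.commute)
  also have "\<dots> = (\<Sum>x::'a\<in>UNIV. if x = 0 then of_nat CARD('a) else 0)"
    by (rule sum.cong[OF refl], simp only: sum_\<psi>) simp
  also have "\<dots> = S 0" by (simp add: S_zero)
  finally show ?thesis by (simp add: sum_diff1)
qed

section \<open>The sign of \<open>S 1\<close> and the values of \<open>S\<close>\<close>

lemma S_of_P: "u \<in> P \<Longrightarrow> S u = S 1"
  using S_mult_P[of u 1] by simp

text \<open>Units of the prime field are \<open>(p - 1)\<close>-th roots of unity, and
  \<open>p - 1\<close> divides \<open>s - 1\<close>, which divides \<open>e\<close>.\<close>

lemma fixed_field_in_P:
  assumes "c ^ p = c" "c \<noteq> 0"
  shows "c \<in> P"
proof (rule P_of_root)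
  have "p = Suc (p - 1)" using p_ge_3 by simp
  then have "c * c ^ (p - 1) = c" using assms(1) by (metis power_Suc)
  then show "c ^ (p - 1) = 1" using assms(2) by simp
  show "p - 1 dvd e"
    using p_minus_one_dvd s_minus_one_dvd_e dvd_trans dvd_mult_right by blast
qed

text \<open>The geometric sum over multiples \<open>k < p\<close> detects \<open>\<psi> = 1\<close>.
  The multipliers \<open>k \<noteq> 0\<close> lie in \<open>P\<close> and so all give
  \<open>S 1\<close>.\<close>

lemma card_\<psi>_eq_one: "of_nat (p * card {x. \<psi> (x ^ (s + 1)) = 1}) = of_nat CARD('a) + of_nat (p - 1) * S 1"
proof -
  have p: "p > 0" using p_ge_3 by simp
  have geom: "(\<Sum>k<p. \<psi> (of_nat k * y)) = (if \<psi> y = 1 then of_nat p else 0)" for y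
    by (simp add: \<psi>_of_nat_mult geometric_sum \<psi>_root)
  have S_k: "S (of_nat k) = S 1" if "k \<in> {0<..<p}" for k
  proof (rule S_of_P, rule fixed_field_in_P)
    show "(of_nat k :: 'a) ^ p = of_nat k"
      using power_char_eq_self_iff[OF prime_p char_p] that by auto
    have "\<not> p dvd k" using that by (auto dest: dvd_imp_le)
    then show "(of_nat k :: 'a) \<noteq> 0" by (simp add: of_nat_eq_0_iff_char_dvd char_p)
  qed
  have "of_nat (p * card {x. \<psi> (x ^ (s + 1)) = 1}) = (\<Sum>x\<in>UNIV. \<Sum>k<p. \<psi> (of_nat k * x ^ (s + 1)))"
    unfolding geom by (simp add: sum.If_cases mult.commute)
  also have "\<dots> = (\<Sum>k<p. S (of_nat k))" unfolding S_def by (rule sum.swap)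
  also have "{..<p} = insert 0 {0<..<p}" using p by auto
  also have "(\<Sum>k\<in>insert 0 {0<..<p}. S (of_nat k)) = S 0 + (\<Sum>k\<in>{0<..<p}. S (of_nat k))"
    by simp
  also have "\<dots> = of_nat CARD('a) + of_nat (p - 1) * S 1"
    by (simp add: S_k S_zero)
  finally show ?thesis .
qed

text \<open>If \<open>h\<close> is a root of unity of this order, then \<open>h ^ (s + 1)\<close>
  lies in the prime field. Multiplying \<open>a\<close> by \<open>h\<close> therefore only raises
  the character value to a power, and 1 stays 1.\<close>

lemma dvd_card_\<psi>_eq_one: "(s + 1) * (p - 1) dvd card ({x. \<psi> (x ^ (s + 1)) = 1} - {0})"
proof -
  obtain k where k: "e = (p - 1) * k"
    using p_minus_one_dvd s_minus_one_dvd_e by (meson dvd_def dvd_mult_right dvd_trans)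
  have n: "CARD('a) - 1 = ((s + 1) * (p - 1)) * k" by (simp only: card_units k mult.assoc)
  show ?thesis
  proof (rule card_dvd_of_roots_invariant[OF g n])
    fix a h :: 'a assume a: "a \<in> {x. \<psi> (x ^ (s + 1)) = 1} - {0}" and h: "h ^ ((s + 1) * (p - 1)) = 1"
    have "p - 1 > 0" using p_ge_3 by simp
    then have h0: "h \<noteq> 0" using h by (auto simp: power_0_left)
    have "(h ^ (s + 1)) ^ Suc (p - 1) = h ^ (s + 1)"
      unfolding power_Suc power_mult[symmetric] h by simp
    then have "(h ^ (s + 1)) ^ p = h ^ (s + 1)" using p_ge_3 by simp
    then obtain j where j: "h ^ (s + 1) = of_nat j"
      using power_char_eq_self_iff[OF prime_p char_p] by blast
    have "(a * h) ^ (s + 1) = of_nat j * a ^ (s + 1)"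
      unfolding power_mult_distrib j by (rule mult.commute)
    then have "\<psi> ((a * h) ^ (s + 1)) = 1" using a by (simp only: \<psi>_of_nat_mult) simp
    then show "a * h \<in> {x. \<psi> (x ^ (s + 1)) = 1} - {0}" using a h0 by simp
  qed simp
qed

text \<open>The magnitude of \<open>S 1\<close> comes from its square. For the sign, the zeros of the trace form
  \<open>Tr (x\<^sup>s\<^sup>+\<^sup>1)\<close> other than \<open>0\<close> form a union of cosets of the roots of unity of order
  \<open>(s + 1) * (p - 1)\<close>, and only the negative sign makes their number divisible by that order.\<close>

lemma S_one: "S 1 = - of_nat (s * Q)"
proof -
  have "\<bar>Re (S 1)\<bar> = real (s * Q)" using Re_S_cases[of 1] one_in_P by simp
  moreover have "Re (S 1) \<noteq> real (s * Q)"
  proof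
    assume "Re (S 1) = real (s * Q)"
    then have S1: "S 1 = of_nat (s * Q)" by (subst S_eq_Re) simp
    let ?N = "{x. \<psi> (x ^ (s + 1)) = 1}"
    have "(of_nat (p * card ?N) :: complex) = of_nat (Q\<^sup>2 + (p - 1) * (s * Q))"
      unfolding card_\<psi>_eq_one S1 card_field by simp
    then have "p * card ?N = Q\<^sup>2 + (p - 1) * (s * Q)" by (simp only: of_nat_eq_iff)
    moreover have "card ?N = Suc (card (?N - {0}))"
      by (rule card.remove) (simp_all add: \<psi>_zero)
    moreover obtain M where "card (?N - {0}) = (s + 1) * (p - 1) * M"
      using dvd_card_\<psi>_eq_one by (elim dvdE)
    ultimately have "p * (1 + (s + 1) * (p - 1) * M) = Q\<^sup>2 + (p - 1) * (s * Q)" by simp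
    then have "int (p * (1 + (s + 1) * (p - 1) * M)) = int (Q\<^sup>2 + (p - 1) * (s * Q))" by simp
    then have eq: "int p + int p * (int s + 1) * (int p - 1) * M = (int Q)\<^sup>2 + (int p - 1) * (int s * int Q)"
    proof -
      have "int (p - 1) = int p - 1" using p_ge_3 by simp
      then have "int p * (1 + (int s + 1) * (int p - 1) * M) = (int Q)\<^sup>2 + (int p - 1) * (int s * int Q)"
        using \<open>int (p * _) = _\<close> by (simp only: of_nat_mult of_nat_add of_nat_power of_nat_1)
      then show ?thesis by (simp add: algebra_simps)
    qed
    obtain a where a: "int s - 1 = (int p - 1) * a"
    proof -
      have "int (p - 1) dvd int (s - 1)" using p_minus_one_dvd by simp
      then show ?thesis using that p_ge_3 s_ge_3 by (auto simp: of_nat_diff elim!: dvdE)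
    qed
    obtain b where b: "int Q - 1 = (int s + 1) * (int s - 1) * b" using Q_cong_one by (elim dvdE)
    have Q1: "int Q = 1 + (int s + 1) * (int s - 1) * b" using b by simp
    \<comment> \<open>Arranged this way, every term is a multiple of \<open>p - 1\<close>, which can
      be cancelled to expose a congruence modulo \<open>s + 1\<close>.\<close>
    have "(int p - 1) * (int s * int Q - 1)
        = int p + int p * (int s + 1) * (int p - 1) * M - (int Q)\<^sup>2 - (int p - 1)"
      using eq by (simp add: algebra_simps)
    also have "\<dots> = int p * (int s + 1) * (int p - 1) * M - (int Q - 1) * (int Q + 1)"
      by (simp add: algebra_simps power2_eq_square)
    also have "\<dots> = (int p - 1) * ((int s + 1) * (int p * M - a * b * (int Q + 1)))"
      unfolding b a by (simp add: algebra_simps)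
    finally have "int s * int Q - 1 = (int s + 1) * (int p * M - a * b * (int Q + 1))"
      using p_ge_3 by simp
    then have "int s + 1 dvd int s * int Q - 1" by simp
    \<comment> \<open>Modulo \<open>s + 1\<close>, \<open>Q\<close> is 1 and \<open>s\<close> is
      \<open>- 1\<close>, so this number is congruent to \<open>- 2\<close>; but
      \<open>s + 1\<close> is at least 4.\<close>
    moreover have "int s * int Q - 1 = (int s + 1) * (1 + int s * (int s - 1) * b) - 2"
      unfolding Q1 by (simp add: algebra_simps)
    ultimately have "int s + 1 dvd 2" by (metis dvd_diff_right_iff dvd_triv_left)
    then show False using s_ge_3 by (auto dest: zdvd_imp_le)
  qed
  ultimately have "Re (S 1) = - real (s * Q)" by (auto simp: abs_if split: if_splits)
  then show ?thesis by (subst S_eq_Re) simp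
qed

text \<open>The elements of \<open>P\<close> contribute \<open>- s * Q * e\<close> to the vanishing
  total. The other \<open>s * e\<close> units contribute at most \<open>Q\<close> each, so all of
  them must attain \<open>Q\<close>.\<close>

lemma S_eq:
  assumes "u \<noteq> 0"
  shows "S u = of_real (real Q - (if u \<in> P then real ((s + 1) * Q) else 0))"
proof (cases "u \<in> P")
  case True
  then show ?thesis by (simp add: S_of_P S_one algebra_simps)
next
  case False
  define R where "R = UNIV - {0} - P"
  have sub: "P \<subseteq> UNIV - {0}" using zero_notin_P by blast
  have card_R: "card R = s * e"
  proof -
    have "card R = CARD('a) - 1 - card P"
      unfolding R_def using sub by (subst card_Diff_subset) (auto simp: card_Diff_singleton)
    then have "card R = (s + 1) * e - e" by (simp only: card_units card_P)
    then show ?thesis by simp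
  qed
  have "0 = (\<Sum>u\<in>UNIV - {0}. Re (S u))" using arg_cong[OF sum_S_nonzero, of Re] by (simp only: Re_sum) simp
  also have "\<dots> = (\<Sum>u\<in>R. Re (S u)) + (\<Sum>u\<in>P. Re (S u))"
    unfolding R_def using sub by (intro sum.subset_diff) auto
  also have "(\<Sum>u\<in>P. Re (S u)) = - real (s * Q * e)"
    by (simp add: S_of_P S_one card_P)
  finally have "(\<Sum>u\<in>R. real Q - Re (S u)) = 0"
    by (simp add: sum_subtractf card_R)
  moreover have "0 \<le> real Q - Re (S u)" if "u \<in> R" for u
    using Re_S_cases[of u] that by (auto simp: R_def)
  ultimately have "real Q - Re (S u) = 0"
    using sum_nonneg_eq_0_iff[of R "\<lambda>u. real Q - Re (S u)"] False assms by (auto simp: R_def)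
  then show ?thesis using False by (subst S_eq_Re) simp
qed


subsection \<open>Cliques in unions of classes of semiprimitive order\<close>

text \<open>The \<open>c\<close> with \<open>x / c\<close> in \<open>P\<close> form the coset of
  \<open>x\<close>, which is contained in \<open>B\<close> or disjoint from it. Every term is
  \<open>Q\<close>, except that these \<open>e\<close> terms drop by \<open>(s + 1) * Q\<close>, and
  \<open>(s + 1) * e = Q^2 - 1\<close>.\<close>

lemma sum_S_divide:
  assumes "0 \<notin> B" and B: "\<forall>b\<in>B. \<forall>w\<in>P. b * w \<in> B"
  shows "(\<Sum>c\<in>B. S (x / c)) = of_real (if x = 0 then real (card B * Q\<^sup>2)
    else real (card B * Q) - (if x \<in> B then real Q * (real Q ^ 2 - 1) else 0))"
proof (cases "x = 0")
  case True
  then show ?thesis by (simp add: S_zero card_field)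
next
  case False
  have "card {c \<in> B. x / c \<in> P} = (if x \<in> B then e else 0)"
  proof (cases "x \<in> B")
    case True
    have "{c \<in> B. x / c \<in> P} = (\<lambda>w. x / w) ` P"
    proof (intro equalityI subsetI)
      fix c assume c: "c \<in> {c \<in> B. x / c \<in> P}"
      then have "c \<noteq> 0" using \<open>0 \<notin> B\<close> by auto
      then have "c = x / (x / c)" using False by simp
      then show "c \<in> (\<lambda>w. x / w) ` P" using c by blast
    next
      fix c assume "c \<in> (\<lambda>w. x / w) ` P"
      then obtain w where w: "w \<in> P" "c = x / w" by blast
      then have "w \<noteq> 0" using zero_notin_P by auto
      have "x * (1 / w) \<in> B" using True w one_in_P by (intro bspec[OF bspec[OF B]] P_divide) auto
      then show "c \<in> {c \<in> B. x / c \<in> P}" using w False \<open>w \<noteq> 0\<close> by simp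
    qed
    moreover have "inj_on (\<lambda>w. x / w) P"
      by (rule inj_onI) (use False zero_notin_P in \<open>auto simp: divide_inverse\<close>)
    ultimately show ?thesis using True by (simp add: card_image card_P)
  next
    case no: False
    have "x \<in> B" if "c \<in> B" "x / c \<in> P" for c
    proof -
      have "c \<noteq> 0" using that \<open>0 \<notin> B\<close> by auto
      then show ?thesis using bspec[OF bspec[OF B that(1)] that(2)] by simp
    qed
    with no have "{c \<in> B. x / c \<in> P} = {}" by blast
    then show ?thesis using no by (simp only: card.empty if_False)
  qed
  moreover have "real ((s + 1) * Q) * real e = real Q * (real Q ^ 2 - 1)"
  proof -
    have "real ((s + 1) * e) = real (Q\<^sup>2) - 1"
      using Q_pos unfolding card_units[symmetric] card_field by (simp add: of_nat_diff)
    then have "real Q * (real Q ^ 2 - 1) = real Q * real ((s + 1) * e)" by simp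
    then show ?thesis by (simp add: algebra_simps)
  qed
  moreover have "(\<Sum>c\<in>B. if x / c \<in> P then real ((s + 1) * Q) else 0)
      = real ((s + 1) * Q) * real (card {c \<in> B. x / c \<in> P})"
    by (simp add: sum.If_cases Int_def)
  ultimately have "(\<Sum>c\<in>B. real Q - (if x / c \<in> P then real ((s + 1) * Q) else 0))
      = real (card B * Q) - (if x \<in> B then real Q * (real Q ^ 2 - 1) else 0)"
    by (simp only: sum_subtractf sum_constant of_nat_mult) simp
  moreover have "(\<Sum>c\<in>B. S (x / c))
      = (\<Sum>c\<in>B. of_real (real Q - (if x / c \<in> P then real ((s + 1) * Q) else 0)))"
    by (intro sum.cong refl S_eq) (use False \<open>0 \<notin> B\<close> in auto)
  ultimately show ?thesis using False by (simp only: of_real_sum[symmetric] if_False)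
qed

section \<open>Moments of the character sum of a clique\<close>

lemma sum_character_square:
  assumes "0 \<notin> B" and "\<forall>b\<in>B. \<forall>w\<in>P. b * w \<in> B"
    and clique: "\<forall>a\<in>A. \<forall>b\<in>A. a \<noteq> b \<longrightarrow> a - b \<in> B"
  shows "(\<Sum>c\<in>B. \<Sum>x\<in>UNIV. (norm (\<Sum>a\<in>A. \<psi> (a / c * x ^ (s + 1))))\<^sup>2)
    = real (card A) * (real (card B) * real Q ^ 2
        + (real (card A) - 1) * (real (card B) * real Q - real Q * (real Q ^ 2 - 1)))"
proof -
  \<comment> \<open>\<open>K\<close> is the common value of the off-diagonal terms: all differences
    of distinct elements of \<open>A\<close> lie in \<open>B\<close>.\<close>
  define K where "K = real (card B) * real Q - real Q * (real Q ^ 2 - 1)"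
  have "complex_of_real (\<Sum>c\<in>B. \<Sum>x\<in>UNIV. (norm (\<Sum>a\<in>A. \<psi> (a / c * x ^ (s + 1))))\<^sup>2)
      = (\<Sum>c\<in>B. \<Sum>x\<in>UNIV. \<Sum>a\<in>A. \<Sum>b\<in>A. \<psi> (a / c * x ^ (s + 1)) * cnj (\<psi> (b / c * x ^ (s + 1))))"
    by (simp only: of_real_sum complex_norm_square cnj_sum sum_product)
  also have "\<dots> = (\<Sum>c\<in>B. \<Sum>x\<in>UNIV. \<Sum>a\<in>A. \<Sum>b\<in>A. \<psi> ((a - b) / c * x ^ (s + 1)))"
    by (simp only: cnj_\<psi> \<psi>_add[symmetric]) (simp add: diff_divide_distrib left_diff_distrib)
  also have "\<dots> = (\<Sum>c\<in>B. \<Sum>a\<in>A. \<Sum>b\<in>A. S ((a - b) / c))"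
    unfolding S_def by (subst sum.swap, subst (2) sum.swap) (rule refl)
  also have "\<dots> = (\<Sum>a\<in>A. \<Sum>b\<in>A. \<Sum>c\<in>B. S ((a - b) / c))"
    by (subst sum.swap, subst (2) sum.swap) (rule refl)
  also have "\<dots> = (\<Sum>a\<in>A. \<Sum>b\<in>A. of_real (if b = a then real (card B) * real Q ^ 2 else K))"
  proof (intro sum.cong refl)
    fix a b assume "a \<in> A" "b \<in> A"
    then show "(\<Sum>c\<in>B. S ((a - b) / c)) = of_real (if b = a then real (card B) * real Q ^ 2 else K)"
      using clique by (subst sum_S_divide[OF assms(1,2)]) (auto simp: K_def)
  qed
  also have "\<dots> = of_real (\<Sum>a\<in>A. \<Sum>b\<in>A. if b = a then real (card B) * real Q ^ 2 else K)"
    by (simp only: of_real_sum)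
  also have "(\<Sum>a\<in>A. \<Sum>b\<in>A. if b = a then real (card B) * real Q ^ 2 else K)
      = (\<Sum>a\<in>A. real (card B) * real Q ^ 2 + (real (card A) - 1) * K)"
  proof (intro sum.cong refl)
    fix a assume a: "a \<in> A"
    then have "card A > 0" by (auto simp: card_gt_0_iff)
    have "(\<Sum>b\<in>A. if b = a then real (card B) * real Q ^ 2 else K)
        = real (card B) * real Q ^ 2 + (\<Sum>b\<in>A - {a}. if b = a then real (card B) * real Q ^ 2 else K)"
      using a by (subst sum.remove[of A a]) auto
    also have "(\<Sum>b\<in>A - {a}. if b = a then real (card B) * real Q ^ 2 else K) = (\<Sum>b\<in>A - {a}. K)"
      by (intro sum.cong) auto
    finally show "(\<Sum>b\<in>A. if b = a then real (card B) * real Q ^ 2 else K)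
        = real (card B) * real Q ^ 2 + (real (card A) - 1) * K"
      using a \<open>card A > 0\<close> by (simp add: card_Diff_singleton of_nat_diff)
  qed
  finally show ?thesis unfolding of_real_eq_iff K_def by simp
qed

lemma sum_character_square_split:
  "(\<Sum>c\<in>B. \<Sum>x\<in>UNIV. (norm (\<Sum>a\<in>A. \<psi> (a / c * x ^ (s + 1))))\<^sup>2)
    = real (card B) * (real (card A))\<^sup>2
      + (\<Sum>c\<in>B. \<Sum>x\<in>UNIV - {0}. (norm (\<Sum>a\<in>A. \<psi> (a / c * x ^ (s + 1))))\<^sup>2)"
proof -
  have "(\<Sum>x\<in>UNIV. (norm (\<Sum>a\<in>A. \<psi> (a / c * x ^ (s + 1))))\<^sup>2)
      = (real (card A))\<^sup>2 + (\<Sum>x\<in>UNIV - {0}. (norm (\<Sum>a\<in>A. \<psi> (a / c * x ^ (s + 1))))\<^sup>2)" for c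
    by (subst sum.remove[of UNIV 0]) (simp_all add: \<psi>_zero)
  then show ?thesis by (simp only: sum.distrib) simp
qed

text \<open>Since \<open>D\<close> consists of half of the units, the terms with \<open>x = 0\<close> exhaust the second moment
  exactly when \<open>card A = Q\<close>.\<close>

lemma half_clique_second_moment:
  assumes "0 \<notin> D" and "\<forall>b\<in>D. \<forall>w\<in>P. b * w \<in> D" and D: "2 * card D = CARD('a) - 1"
    and "\<forall>a\<in>A. \<forall>b\<in>A. a \<noteq> b \<longrightarrow> a - b \<in> D"
  shows "(\<Sum>c\<in>D. \<Sum>x\<in>UNIV - {0}. (norm (\<Sum>a\<in>A. \<psi> (a / c * x ^ (s + 1))))\<^sup>2)
    = real (card A) * real (card D) * (real Q + 1) * (real Q - real (card A))"
proof -
  have "real (2 * card D) = real Q ^ 2 - 1"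
    using Q_pos unfolding D card_field by (simp add: of_nat_diff)
  then have Q2: "real Q ^ 2 - 1 = 2 * real (card D)" by simp
  have "(\<Sum>c\<in>D. \<Sum>x\<in>UNIV - {0}. (norm (\<Sum>a\<in>A. \<psi> (a / c * x ^ (s + 1))))\<^sup>2)
     = real (card A) * (real (card D) * real Q ^ 2
        + (real (card A) - 1) * (real (card D) * real Q - real Q * (2 * real (card D))))
        - real (card D) * (real (card A))\<^sup>2"
    using sum_character_square[OF assms(1,2,4)] sum_character_square_split[of A D] unfolding Q2
    by linarith
  then show ?thesis by (simp add: algebra_simps power2_eq_square)
qed

text \<open>The second moment over \<open>x \<noteq> 0\<close> is a sum of squares, but its closed
  form is negative once \<open>card A\<close> exceeds \<open>Q\<close>.\<close>

lemma half_clique_card_le: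
  assumes "0 \<notin> D" and "\<forall>b\<in>D. \<forall>w\<in>P. b * w \<in> D" and D: "2 * card D = CARD('a) - 1"
    and "\<forall>a\<in>A. \<forall>b\<in>A. a \<noteq> b \<longrightarrow> a - b \<in> D"
  shows "card A \<le> Q"
proof (rule ccontr)
  assume A: "\<not> card A \<le> Q"
  have "card D > 0" using D card_field_minus_one_pos[where 'a = 'a] by simp
  then have "real (card A) * real (card D) * (real Q + 1) * (real Q - real (card A)) < 0"
    using A by (intro mult_pos_neg mult_pos_pos) auto
  moreover have "real (card A) * real (card D) * (real Q + 1) * (real Q - real (card A)) \<ge> 0"
    unfolding half_clique_second_moment[OF assms, symmetric] by (intro sum_nonneg) auto
  ultimately show False by simp
qed

text \<open>When \<open>card A = Q\<close> the second moment over \<open>x \<noteq> 0\<close>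
  vanishes, hence so does every single sum. The first moment over \<open>B\<close> is then
  \<open>card B * Q\<close>, from \<open>x = 0\<close> alone; evaluated through
  \<open>sum_S_divide\<close>, it depends on \<open>card (A \<inter> B)\<close>.\<close>

lemma half_clique_equidistribution:
  assumes "0 \<notin> D" and "\<forall>b\<in>D. \<forall>w\<in>P. b * w \<in> D" and D: "2 * card D = CARD('a) - 1"
    and "\<forall>a\<in>A. \<forall>b\<in>A. a \<noteq> b \<longrightarrow> a - b \<in> D"
    and cardA: "card A = Q" and A0: "0 \<in> A"
    and BD: "B \<subseteq> D" and B: "\<forall>b\<in>B. \<forall>w\<in>P. b * w \<in> B"
  shows "card (A \<inter> B) * (Q + 1) = 2 * card B"
proof -
  let ?F = "\<lambda>c x. \<Sum>a\<in>A. \<psi> (a / c * x ^ (s + 1))"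
  have B0: "0 \<notin> B" using BD assms(1) by blast
  have "(\<Sum>c\<in>D. \<Sum>x\<in>UNIV - {0}. (norm (?F c x))\<^sup>2) = 0"
    using half_clique_second_moment[OF assms(1-4)] cardA by simp
  then have "\<forall>c\<in>D. (\<Sum>x\<in>UNIV - {0}. (norm (?F c x))\<^sup>2) = 0"
    by (subst (asm) sum_nonneg_eq_0_iff) (auto intro: sum_nonneg)
  then have F0: "?F c x = 0" if "c \<in> D" "x \<noteq> 0" for c x
    using that by (subst (asm) sum_nonneg_eq_0_iff) auto
  have "(\<Sum>c\<in>B. \<Sum>x\<in>UNIV. ?F c x) = (\<Sum>c\<in>B. of_nat Q)"
  proof (rule sum.cong[OF refl])
    fix c assume "c \<in> B"
    then have "(\<Sum>x\<in>UNIV - {0}. ?F c x) = 0" using F0 BD by (intro sum.neutral) auto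
    moreover have "?F c 0 = of_nat Q" by (simp add: \<psi>_zero cardA)
    ultimately show "(\<Sum>x\<in>UNIV. ?F c x) = of_nat Q" by (subst sum.remove[of UNIV 0]) simp_all
  qed
  moreover have "(\<Sum>c\<in>B. \<Sum>x\<in>UNIV. ?F c x) = (\<Sum>b\<in>A. \<Sum>c\<in>B. S (b / c))"
    unfolding S_def by (subst (2) sum.swap, subst sum.swap) (rule refl)
  ultimately have "complex_of_real (real (card B) * real Q) = (\<Sum>b\<in>A. \<Sum>c\<in>B. S (b / c))"
    by simp
  also have "\<dots> = of_real (\<Sum>b\<in>A. if b = 0 then real (card B * Q\<^sup>2)
      else real (card B * Q) - (if b \<in> B then real Q * (real Q ^ 2 - 1) else 0))"
    unfolding sum_S_divide[OF B0 B] by (simp only: of_real_sum)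
  finally have "real (card B) * real Q = (\<Sum>b\<in>A. if b = 0 then real (card B * Q\<^sup>2)
      else real (card B * Q) - (if b \<in> B then real Q * (real Q ^ 2 - 1) else 0))"
    by (simp only: of_real_eq_iff)
  also have "\<dots> = real (card B * Q\<^sup>2) + (\<Sum>b\<in>A - {0}.
      real (card B * Q) - (if b \<in> B then real Q * (real Q ^ 2 - 1) else 0))"
    using A0 by (subst sum.remove[of A 0]) (auto intro: sum.cong)
  also have "(\<Sum>b\<in>A - {0}. real (card B * Q) - (if b \<in> B then real Q * (real Q ^ 2 - 1) else 0))
      = (real Q - 1) * real (card B * Q) - real (card (A \<inter> B)) * (real Q * (real Q ^ 2 - 1))"
  proof -
    have "(A - {0}) \<inter> B = A \<inter> B" using B0 by blast
    moreover have "real (card (A - {0})) = real Q - 1"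
      using A0 cardA Q_pos by (simp add: card_Diff_singleton of_nat_diff)
    ultimately show ?thesis by (simp add: sum_subtractf sum.If_cases)
  qed
  finally have "(real Q * (real Q - 1)) * (real (card (A \<inter> B)) * (real Q + 1))
      = (real Q * (real Q - 1)) * (2 * real (card B))"
    by (simp add: algebra_simps power2_eq_square)
  \<comment> \<open>Positivity of \<open>r\<close> gives \<open>Q \<ge> s\<close>, so
    \<open>Q\<close> is not 1 and the common factor can be cancelled.\<close>
  moreover have "real Q * (real Q - 1) \<noteq> 0"
  proof -
    have "s ^ 1 \<le> Q" unfolding Q_def using s_ge_3 r_pos by (intro power_increasing) auto
    then show ?thesis using s_ge_3 by simp
  qed
  ultimately have "real (card (A \<inter> B)) * (real Q + 1) = 2 * real (card B)"
    by (simp only: mult_cancel_left) simp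
  then have "real (card (A \<inter> B) * (Q + 1)) = real (2 * card B)" by (simp add: algebra_simps)
  then show ?thesis by (simp only: of_nat_eq_iff)
qed

end

subsection \<open>Cyclotomic classes\<close>

context
  fixes g :: "'a::{field,finite}"
  assumes g: "field_primitive_root g"
begin

text \<open>Since \<open>g\<close> generates the units, the integer powers of \<open>g ^ N\<close>
  are exactly the \<open>N\<close>-th powers of units.\<close>

lemma cyclotomic_class_eq:
  "cyclotomic_class g N (int m) = (\<lambda>z. g ^ m * z ^ N) ` (UNIV - {0})"
proof -
  have pow: "(g ^ N) powi k = (g powi k) ^ N" for k
    by (simp add: power_int_def power_inverse power_mult[symmetric] mult.commute)
  have "range (\<lambda>k. (g ^ N) powi k) = (\<lambda>z. z ^ N) ` (UNIV - {0})"
  proof (intro equalityI subsetI)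
    fix x :: 'a assume "x \<in> range (\<lambda>k. (g ^ N) powi k)"
    then obtain k where "x = (g powi k) ^ N" by (auto simp: pow)
    then show "x \<in> (\<lambda>z. z ^ N) ` (UNIV - {0})"
      using primitive_root_nonzero[OF g] by (auto simp: power_int_eq_0_iff)
  next
    fix x :: 'a assume "x \<in> (\<lambda>z. z ^ N) ` (UNIV - {0})"
    then obtain z where z: "z \<noteq> 0" "x = z ^ N" by auto
    then obtain k where "z = g ^ k" using g by (auto simp: field_primitive_root_def)
    then have "x = (g ^ N) powi int k" using z by (simp add: power_mult[symmetric] mult.commute)
    then show "x \<in> range (\<lambda>k. (g ^ N) powi k)" by blast
  qed
  then show ?thesis by (simp add: cyclotomic_class_def image_image)
qed

lemma zero_notin_cyclotomic_class: "0 \<notin> cyclotomic_class g N (int m)"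
  using primitive_root_nonzero[OF g] by (auto simp: cyclotomic_class_eq)

lemma cyclotomic_class_mult_power:
  assumes "x \<in> cyclotomic_class g N (int m)" and "z \<noteq> 0"
  shows "x * z ^ N \<in> cyclotomic_class g N (int m)"
proof -
  obtain y where "y \<noteq> 0" "x = g ^ m * y ^ N" using assms(1) by (auto simp: cyclotomic_class_eq)
  then have "x * z ^ N = g ^ m * (y * z) ^ N" "y * z \<noteq> 0"
    using assms(2) by (simp_all add: power_mult_distrib mult.assoc)
  then show ?thesis by (auto simp: cyclotomic_class_eq)
qed

lemma card_cyclotomic_class:
  assumes n: "CARD('a) - 1 = N * e"
  shows "card (cyclotomic_class g N (int m)) = e"
proof -
  have e: "e > 0" using n card_field_minus_one_pos[where 'a = 'a] by (auto intro!: Nat.gr0I)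
  have N: "N > 0" using n card_field_minus_one_pos[where 'a = 'a] by (auto intro!: Nat.gr0I)
  have "(\<lambda>z. z ^ N) ` (UNIV - {0}) = {y::'a. y ^ e = 1}"
  proof (intro equalityI subsetI)
    fix y :: 'a assume "y \<in> (\<lambda>z. z ^ N) ` (UNIV - {0})"
    then obtain z where z: "z \<noteq> 0" "y = z ^ N" by auto
    then have "y \<noteq> 0" by simp
    then show "y \<in> {y. y ^ e = 1}" using is_power_iff[OF g n] z(2) by blast
  next
    fix y :: 'a assume y: "y \<in> {y. y ^ e = 1}"
    then have "y \<noteq> 0" using e by (auto simp: power_0_left)
    then obtain z where "y = z ^ N" using is_power_iff[OF g n, of y] y by auto
    moreover from this \<open>y \<noteq> 0\<close> N have "z \<noteq> 0" by (auto simp: power_0_left)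
    ultimately show "y \<in> (\<lambda>z. z ^ N) ` (UNIV - {0})" by auto
  qed
  then have "card ((\<lambda>z::'a. z ^ N) ` (UNIV - {0})) = e"
    using card_roots_of_one[OF g trans[OF n mult.commute]] by simp
  moreover have "cyclotomic_class g N (int m) = (*) (g ^ m) ` (\<lambda>z. z ^ N) ` (UNIV - {0})"
    by (simp add: cyclotomic_class_eq image_image)
  moreover have "inj_on ((*) (g ^ m)) A" for A
    using primitive_root_nonzero[OF g] by (auto intro: inj_onI)
  ultimately show ?thesis by (simp add: card_image)
qed

text \<open>Raising to the power \<open>e\<close> is constant on each class, with value
  \<open>g ^ (m * e)\<close>; these values differ for different \<open>m < N\<close>.\<close>

lemma cyclotomic_class_disjoint:
  assumes n: "CARD('a) - 1 = N * e" and "i < N" "j < N" "i \<noteq> j"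
  shows "cyclotomic_class g N (int i) \<inter> cyclotomic_class g N (int j) = {}"
proof -
  have e: "e > 0" using n card_field_minus_one_pos[where 'a = 'a] by (auto intro!: Nat.gr0I)
  have *: False if "x \<in> cyclotomic_class g N (int i)" "x \<in> cyclotomic_class g N (int j)"
    "i < j" "j < N" for x i j
  proof -
    have power_e: "x ^ e = g ^ (m * e)" if x: "x \<in> cyclotomic_class g N (int m)" for x m
    proof -
      obtain y where "y \<noteq> 0" "x = g ^ m * y ^ N" using x by (auto simp: cyclotomic_class_eq)
      then show ?thesis
        using power_card_minus_one[of y] unfolding n by (simp add: power_mult_distrib power_mult)
    qed
    have "i * e = j * e"
      using power_e[OF that(1)] power_e[OF that(2)] that(3,4) e n
      by (intro inj_onD[OF primitive_root_inj[OF g]]) auto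
    then show False using e that(3) by simp
  qed
  show ?thesis
    using *[of _ i j] *[of _ j i] assms(2-4) by (meson disjoint_iff linorder_neqE_nat)
qed

lemma card_PP_connection_set:
  assumes n: "CARD('a) - 1 = N * e" and "I \<subseteq> {0..<N}"
  shows "card (PP_connection_set g N I) = card I * e"
proof -
  have "finite I" using assms(2) finite_subset by blast
  then have "card (PP_connection_set g N I) = (\<Sum>m\<in>I. card (cyclotomic_class g N (int m)))"
    unfolding PP_connection_set_def
    by (intro card_UN_disjoint) (use assms cyclotomic_class_disjoint[OF n] in \<open>auto simp: subset_iff\<close>)
  then show ?thesis by (simp add: card_cyclotomic_class[OF n])
qed

end

section \<open>The clique bound and equal distribution over the classes\<close>

theorem theorem1p6:
  fixes p d t r q :: nat and g :: "'a::{field,finite}" and I :: "nat set"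
  assumes "prime p" and "odd p"
    and "d \<ge> 1"
    and "\<exists>k::nat. [int p ^ k = - 1] (mod int (2 * d))"
    and "t = (LEAST s::nat. s > 0 \<and> [int p ^ s = - 1] (mod int (2 * d)))"
    and "even r" and "r > 0"
    and "q = p ^ (2 * r * t)"
    and "CARD('a) = q"
    and "field_primitive_root g"
    and "I \<subseteq> {0..<2 * d}" and "card I = d"
  shows "real (clique_number UNIV (PP_edges g (2 * d) I)) \<le> sqrt (real q) \<and>
    (real (clique_number UNIV (PP_edges g (2 * d) I)) = sqrt (real q) \<longrightarrow>
      (\<forall>A. clique A (PP_edges g (2 * d) I) \<and> real (card A) = sqrt (real q) \<and> 0 \<in> A \<longrightarrow>
        (\<forall>m\<in>I. real (card (A \<inter> cyclotomic_class g (2 * d) (int m))) = (sqrt (real q) - 1) / real d)))"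
proof -
  have "\<exists>s::nat. s > 0 \<and> [int p ^ s = - 1] (mod int (2 * d))"
  proof -
    obtain k where k: "[int p ^ k = - 1] (mod int (2 * d))" using assms(4) by blast
    show ?thesis
    proof (cases "k = 0")
      \<comment> \<open>Exponent 0 is possible only for \<open>d = 1\<close>, and then exponent 1
        works because \<open>p\<close> is odd.\<close>
      case True
      then have "int (2 * d) dvd 2" using k by (simp add: cong_iff_dvd_diff)
      then have "d = 1" using assms(3) by (auto dest: zdvd_imp_le)
      moreover have "[int p ^ 1 = - 1] (mod 2)" using assms(2) by (simp add: cong_iff_dvd_diff)
      ultimately show ?thesis by (intro exI[of _ 1]) simp
    qed (use k in blast)
  qed
  then have "t > 0 \<and> [int p ^ t = - 1] (mod int (2 * d))"
    unfolding assms(5) by (rule LeastI_ex)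
  then have t: "t > 0" and "int (2 * d) dvd int (p ^ t + 1)"
    by (auto simp: cong_iff_dvd_diff add.commute)
  then have dvd_s: "2 * d dvd p ^ t + 1" by (simp only: of_nat_dvd_iff)
  have card: "CARD('a) = p ^ (2 * r * t)" using assms(8,9) by simp
  obtain \<psi> :: "'a \<Rightarrow> complex" where \<psi>: "\<And>x y. \<psi> (x + y) = \<psi> x * \<psi> y" "\<And>x. \<psi> (x ^ p) = \<psi> x"
    "\<And>x. \<psi> x ^ p = 1" "\<exists>x. \<psi> x \<noteq> 1"
    by (rule exists_frobenius_invariant_character[OF assms(1) card]) (use t assms(7) in auto)
  interpret semiprimitive_character p t r g \<psi>
    by unfold_locales (use assms t card \<psi> in simp_all)
  obtain k where k: "s + 1 = 2 * d * k" using dvd_s by (auto simp: s_def)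
  define f where "f = k * e"
  have n: "CARD('a) - 1 = 2 * d * f" unfolding card_units k f_def by simp
  have "even f"
    using s_minus_one_dvd_e by (auto simp: f_def dest: dvd_mult_left)
  then obtain f' where f': "f = 2 * f'" ..
  \<comment> \<open>The stronger divisibility by \<open>4 * d\<close> makes the connection set
    symmetric, as \<open>PP_edge_iff\<close> requires.\<close>
  have dvd_units: "2 * (2 * d) dvd CARD('a) - 1" unfolding n f' by simp
  have sqrt_q: "sqrt (real q) = real Q"
    by (simp add: card_field flip: assms(9))
  define D where "D = PP_connection_set g (2 * d) I"
  let ?E = "PP_edges g (2 * d) I"
  \<comment> \<open>As \<open>2 * d\<close> divides \<open>s + 1\<close>, every element of
    \<open>P\<close> is a \<open>2 * d\<close>-th power, so multiplication by it preserves each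
    class.\<close>
  have invariant: "\<forall>b\<in>cyclotomic_class g (2 * d) (int m). \<forall>w\<in>P. b * w \<in> cyclotomic_class g (2 * d) (int m)" for m
  proof (intro ballI)
    fix b w assume b: "b \<in> cyclotomic_class g (2 * d) (int m)" and "w \<in> P"
    then obtain z where z: "w \<noteq> 0" "w = z ^ (s + 1)" by (auto simp: P_def)
    then have "z ^ k \<noteq> 0" "w = (z ^ k) ^ (2 * d)"
      unfolding k mult.commute[of "2 * d"] power_mult using assms(3)
      by (auto simp: zero_power)
    then show "b * w \<in> cyclotomic_class g (2 * d) (int m)"
      using b cyclotomic_class_mult_power[OF assms(10)] by simp
  qed
  have D0: "0 \<notin> D"
    using zero_notin_cyclotomic_class[OF assms(10)] by (auto simp: D_def PP_connection_set_def)
  have D_inv: "\<forall>b\<in>D. \<forall>w\<in>P. b * w \<in> D"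
    using invariant by (auto simp: D_def PP_connection_set_def)
  have card_D: "2 * card D = CARD('a) - 1"
    unfolding D_def card_PP_connection_set[OF assms(10) n assms(11)] n assms(12) by simp
  have diff: "\<forall>a\<in>A. \<forall>b\<in>A. a \<noteq> b \<longrightarrow> a - b \<in> D" if "clique A ?E" for A
    using that PP_edge_iff[OF assms(10) dvd_units] by (simp add: clique_def D_def)
  have le: "card A \<le> Q" if "clique A ?E" for A
    by (rule half_clique_card_le[OF D0 D_inv card_D diff[OF that]])
  have "clique_number UNIV ?E \<in> card ` {A. A \<subseteq> UNIV \<and> clique A ?E}"
    \<comment> \<open>The empty clique ensures that the maximum is taken over a nonempty
      set.\<close>
    unfolding clique_number_def by (rule Max_in) (auto intro!: exI[of _ "{}"])
  then have "real (clique_number UNIV ?E) \<le> sqrt (real q)"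
    using le by (auto simp: sqrt_q)
  moreover have "real (card (A \<inter> cyclotomic_class g (2 * d) (int m))) = (sqrt (real q) - 1) / real d"
    if A: "clique A ?E" "real (card A) = sqrt (real q)" "0 \<in> A" and m: "m \<in> I" for A m
  proof -
    let ?C = "cyclotomic_class g (2 * d) (int m)"
    have "card (A \<inter> ?C) * (Q + 1) = 2 * card ?C"
    proof (rule half_clique_equidistribution[OF D0 D_inv card_D diff[OF A(1)] _ A(3) _ invariant])
      show "card A = Q" using A(2) by (simp add: sqrt_q)
      show "?C \<subseteq> D" using m by (auto simp: D_def PP_connection_set_def)
    qed
    then have "real (card (A \<inter> ?C) * (Q + 1)) = real (2 * f)"
      by (simp only: card_cyclotomic_class[OF assms(10) n])
    \<comment> \<open>Multiplying by \<open>d\<close> turns the right side into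
      \<open>q - 1 = (Q - 1) * (Q + 1)\<close>, from which \<open>Q + 1\<close> cancels.\<close>
    then have "real (card (A \<inter> ?C)) * (real Q + 1) * real d = real (2 * d * f)"
      by (simp add: algebra_simps)
    also have "\<dots> = (real Q - 1) * (real Q + 1)"
      unfolding n[symmetric] card_field using Q_pos
      by (simp add: of_nat_diff algebra_simps power2_eq_square)
    finally have "(real Q + 1) * (real (card (A \<inter> ?C)) * real d) = (real Q + 1) * (real Q - 1)"
      by (simp only: mult_ac)
    moreover have "real Q + 1 \<noteq> 0" using Q_pos by linarith
    ultimately have "real (card (A \<inter> ?C)) * real d = real Q - 1"
      by (simp only: mult_cancel_left) simp
    then show ?thesis using assms(3) by (simp add: sqrt_q field_simps)
  qed
  ultimately show ?thesis by blast
qed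

end
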